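(* Let $\alpha\in(0,1)$ be irrational and let $J\ge N_*\ge 0$ be integers. Suppose that $$\theta_j\notin M\quad(0\le j\le J),\qquad \theta_{N_*}\in R.$$ Let $$\mathcal{R}_J=\{n: N_*\le n\le J\text{ and }\theta_n\in R\},$$ and for $n\in\mathcal{R}_J$ define the truncated subsequent $L$-run length $$\ell_J(n)=\max\{\ell: 0\le\ell\le J-n,\ \theta_{n+1},\ldots,\theta_{n+\ell}\in L\}$$ (the condition being vacuous for $\ell=0$). Then the integer intervals $$I_n=\{n,n+1,\ldots,n+\ell_J(n)\}\qquad(n\in\mathcal{R}_J)$$ are pairwise disjoint and partition $\{N_*,\ldots,J\}$. Hence $$J-N_*+1=\sum_{n\in\mathcal{R}_J}\bigl(1+\ell_J(n)\bigr).$$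
   Context: Let $L=[0,1/3)$, $M=[1/3,2/3)$, $R=[2/3,1)$. For an irrational $\alpha\in(0,1)$ and an integer $n\ge 0$, $\theta_n=\{3^n\alpha\}$ is the fractional part of $3^n\alpha$. *)

theory Defs
  imports Complex_Main "HOL-Library.Disjoint_Sets"
begin

definition L_set :: "real set" where
  "L_set = {0..<1/3}"

definition M_set :: "real set" where
  "M_set = {1/3..<2/3}"

definition R_set :: "real set" where
  "R_set = {2/3..<1}"

definition theta :: "real \<Rightarrow> nat \<Rightarrow> real" where
  "theta \<alpha> n = frac (3 ^ n * \<alpha>)"

definition R_indices :: "real \<Rightarrow> nat \<Rightarrow> nat \<Rightarrow> nat set" where
  "R_indices \<alpha> N J = {n. N \<le> n \<and> n \<le> J \<and> theta \<alpha> n \<in> R_set}"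

(* Only meaningful for n \<le> J: then the natural-number difference J - n is not truncated,
   and the set under Max is finite and contains 0. *)
definition run_length :: "real \<Rightarrow> nat \<Rightarrow> nat \<Rightarrow> nat" where
  "run_length \<alpha> J n =
     Max {l. 0 \<le> l \<and> l \<le> J - n \<and> (\<forall>i\<in>{1..l}. theta \<alpha> (n + i) \<in> L_set)}"

definition run_interval :: "real \<Rightarrow> nat \<Rightarrow> nat \<Rightarrow> nat set" where
  "run_interval \<alpha> J n = {n..n + run_length \<alpha> J n}"

end

theory Submission
  imports Defs
begin

text \<open>
  The interval at \<open>n\<close> consists of the \<open>k\<close> in \<open>{n..J}\<close> with no index in \<open>{n<..k}\<close> outside
  \<open>L\<close> (\<open>mem_run_interval_iff\<close>). When \<open>M\<close> is avoided, "outside \<open>L\<close>" means "in \<open>R\<close>", so the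
  interval at an \<open>R\<close>-index \<open>n\<close> collects exactly those \<open>k\<close> whose last \<open>R\<close>-index is \<open>n\<close>. Every
  \<open>k\<close> in \<open>{N..J}\<close> has exactly one last \<open>R\<close>-index, since \<open>N\<close> itself is an \<open>R\<close>-index. This is
  the partition; the identity for \<open>J - N + 1\<close> counts its elements.
\<close>

lemma theta_trichotomy: "theta \<alpha> n \<in> L_set \<or> theta \<alpha> n \<in> M_set \<or> theta \<alpha> n \<in> R_set"
  using frac_ge_0[of "3 ^ n * \<alpha>"] frac_lt_1[of "3 ^ n * \<alpha>"]
  by (auto simp: theta_def L_set_def M_set_def R_set_def)

lemma L_set_R_set_disjoint: "x \<in> L_set \<Longrightarrow> x \<notin> R_set"
  by (auto simp: L_set_def R_set_def)

text \<open>The lengths admitted in the maximum are closed under decreasing, so a length is at most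
  the maximum exactly when it is itself admitted.\<close>

lemma le_run_length_iff:
  "l \<le> run_length \<alpha> J n \<longleftrightarrow> l \<le> J - n \<and> (\<forall>i\<in>{1..l}. theta \<alpha> (n + i) \<in> L_set)"
proof -
  let ?A = "{l. 0 \<le> l \<and> l \<le> J - n \<and> (\<forall>i\<in>{1..l}. theta \<alpha> (n + i) \<in> L_set)}"
  have fin: "finite ?A"
    by (rule finite_subset[of _ "{..J - n}"]) auto
  have ne: "?A \<noteq> {}"
    by (auto intro: exI[of _ 0])
  have "l \<le> Max ?A \<longleftrightarrow> (\<exists>m\<in>?A. l \<le> m)"
    by (rule Max_ge_iff[OF fin ne])
  also have "\<dots> \<longleftrightarrow> l \<in> ?A"
    by fastforce
  finally show ?thesis
    by (simp add: run_length_def)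
qed

lemma mem_run_interval_iff:
  assumes "n \<le> J"
  shows "k \<in> run_interval \<alpha> J n \<longleftrightarrow>
    n \<le> k \<and> k \<le> J \<and> (\<forall>m\<in>{n<..k}. theta \<alpha> m \<in> L_set)"
proof (cases "n \<le> k")
  case True
  have "(\<forall>i\<in>{1..k - n}. theta \<alpha> (n + i) \<in> L_set) \<longleftrightarrow> (\<forall>m\<in>{n<..k}. theta \<alpha> m \<in> L_set)"
  proof -
    have "{n<..k} = (\<lambda>i. n + i) ` {1..k - n}"
      using True by (auto simp: image_add_atLeastAtMost)
    then show ?thesis
      by (simp only: ball_simps)
  qed
  moreover have "k \<in> run_interval \<alpha> J n \<longleftrightarrow> k - n \<le> run_length \<alpha> J n"
    using True by (auto simp: run_interval_def)
  ultimately show ?thesis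
    using True assms by (auto simp: le_run_length_iff)
qed (simp add: run_interval_def)

text \<open>Of two overlapping runs, the later would start inside the earlier one, at an index
  whose value would lie in both \<open>L\<close> and \<open>R\<close>.\<close>

lemma run_intervals_disjoint:
  "disjoint_family_on (run_interval \<alpha> J) (R_indices \<alpha> N J)"
proof -
  have no_overlap: "k \<notin> run_interval \<alpha> J n'"
    if "n \<in> R_indices \<alpha> N J" "n' \<in> R_indices \<alpha> N J" "n < n'" "k \<in> run_interval \<alpha> J n"
    for n n' k
    using that L_set_R_set_disjoint[of "theta \<alpha> n'"]
    by (auto simp: R_indices_def mem_run_interval_iff)
  show ?thesis
    unfolding disjoint_family_on_def
    using no_overlap by (metis disjoint_iff nat_neq_iff)
qed

text \<open>Each \<open>k\<close> is covered by the run starting at the last \<open>R\<close>-index not exceeding \<open>k\<close>.\<close>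

lemma run_intervals_cover:
  assumes avoid: "\<And>j. N \<le> j \<Longrightarrow> j \<le> J \<Longrightarrow> theta \<alpha> j \<notin> M_set"
    and start: "theta \<alpha> N \<in> R_set"
  shows "(\<Union>n\<in>R_indices \<alpha> N J. run_interval \<alpha> J n) = {N..J}"
proof (intro equalityI subsetI)
  fix k assume "k \<in> (\<Union>n\<in>R_indices \<alpha> N J. run_interval \<alpha> J n)"
  then show "k \<in> {N..J}"
    by (auto simp: R_indices_def mem_run_interval_iff)
next
  fix k assume k: "k \<in> {N..J}"
  define S where "S = {n \<in> R_indices \<alpha> N J. n \<le> k}"
  define n where "n = Max S"
  have fin: "finite S"
    by (rule finite_subset[of _ "{..k}"]) (auto simp: S_def)
  moreover have "N \<in> S"
    using k start by (auto simp: S_def R_indices_def)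
  ultimately have "n \<in> S"
    unfolding n_def by (intro Max_in) auto
  then have n: "n \<in> R_indices \<alpha> N J" "n \<le> k" "N \<le> n" "n \<le> J"
    by (auto simp: S_def R_indices_def)
  have "theta \<alpha> m \<in> L_set" if m: "m \<in> {n<..k}" for m
  proof -
    have "m \<notin> S"
      using Max_ge[OF fin, of m] m by (auto simp: n_def)
    then have "theta \<alpha> m \<notin> R_set"
      using m k n by (auto simp: S_def R_indices_def)
    moreover have "theta \<alpha> m \<notin> M_set"
      using m k n by (intro avoid) auto
    ultimately show ?thesis
      using theta_trichotomy by blast
  qed
  then have "k \<in> run_interval \<alpha> J n"
    using k n by (simp add: mem_run_interval_iff)
  with n show "k \<in> (\<Union>n\<in>R_indices \<alpha> N J. run_interval \<alpha> J n)"
    by blast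
qed

theorem lemma6p1:
  fixes \<alpha> :: real and N J :: nat
  assumes "\<alpha> \<in> {0<..<1}"
    and "\<alpha> \<notin> \<rat>"
    and "N \<le> J"
    and "\<forall>j. 0 \<le> j \<and> j \<le> J \<longrightarrow> theta \<alpha> j \<notin> M_set"
    and "theta \<alpha> N \<in> R_set"
  shows "disjoint_family_on (run_interval \<alpha> J) (R_indices \<alpha> N J)
    \<and> partition_on {N..J} (run_interval \<alpha> J ` R_indices \<alpha> N J)
    \<and> J - N + 1 = (\<Sum>n\<in>R_indices \<alpha> N J. 1 + run_length \<alpha> J n)"
proof (intro conjI)
  show disj: "disjoint_family_on (run_interval \<alpha> J) (R_indices \<alpha> N J)"
    by (rule run_intervals_disjoint)
  have cover: "(\<Union>n\<in>R_indices \<alpha> N J. run_interval \<alpha> J n) = {N..J}"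
    using assms by (intro run_intervals_cover) auto
  show "partition_on {N..J} (run_interval \<alpha> J ` R_indices \<alpha> N J)"
    using cover disjoint_family_on_disjoint_image[OF disj]
    by (auto simp: partition_on_def run_interval_def)
  have fin: "finite (R_indices \<alpha> N J)"
    by (rule finite_subset[of _ "{..J}"]) (auto simp: R_indices_def)
  have "J - N + 1 = card {N..J}"
    using \<open>N \<le> J\<close> by simp
  also have "\<dots> = (\<Sum>n\<in>R_indices \<alpha> N J. card (run_interval \<alpha> J n))"
    unfolding cover[symmetric] using fin disj
    by (intro card_UN_disjoint) (auto simp: run_interval_def disjoint_family_on_def)
  also have "\<dots> = (\<Sum>n\<in>R_indices \<alpha> N J. 1 + run_length \<alpha> J n)"
    by (simp add: run_interval_def)
  finally show "J - N + 1 = (\<Sum>n\<in>R_indices \<alpha> N J. 1 + run_length \<alpha> J n)" .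
qed

end
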